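(* Let $X$ be a set. Giving a P{\l}onka bi-magma structure $(X,\cdot,\ast)$ on $X$ is equivalent to specifying a partition $X=\coprod_{i\in I}X_i$ and a pair of tuples $(f_i^j)_{(i,j)\in I\times I}$, $(g_i^j)_{(i,j)\in I\times I}$ of functions $f_i^j,g_i^j:X_i\to X_i$ such that for all $i,j,k\in I$ $$f_i^j\circ f_i^k=f_i^k\circ f_i^j,\qquad g_i^j\circ g_i^k=g_i^k\circ g_i^j,\qquad g_i^j\circ f_i^k=f_i^k\circ g_i^j,$$ where the P{\l}onka bi-magma associated to such data is given by $$x_i\cdot x_j=f_i^j(x_i),\qquad x_i\ast x_j=g_j^i(x_j)\qquad\text{for all }x_i\in X_i,\ x_j\in X_j,\ i,j\in I.$$ That is, a bi-magma $(X,\cdot,\ast)$ is a P{\l}onka bi-magma if and only if its operations are given by these formulas for some such data. Furthermore, the P{\l}onka bi-magma associated to such data is unitary if and only if $f_i^j$ and $g_i^j$ are bijective functions inverse to each other, for all $i,j\in I$.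
   Context: A bi-magma $(X,\cdot,\ast)$ is a set with two binary operations. A P{\l}onka bi-magma is a bi-magma such that for all $x,y,z\in X$: - $(x\cdot y)\cdot z=(x\cdot z)\cdot y$ and $x\cdot(y\cdot z)=x\cdot y$; - $x\ast(y\ast z)=y\ast(x\ast z)$ and $(x\ast y)\ast z=y\ast z$; - $x\ast(y\cdot z)=(x\ast y)\cdot z$, $\ (x\cdot z)\ast y=x\ast y$, $\ x\cdot(y\ast z)=x\cdot z$. It is unitary if $(x\ast y)\cdot x=y$ for all $x,y\in X$. The parts of a partition are non-empty. *)

theory Defs
  imports "HOL-Library.Disjoint_Sets" "HOL-Library.FuncSet"
begin

locale bi_magma =
  fixes X :: "'a set"
    and dot :: "'a \<Rightarrow> 'a \<Rightarrow> 'a" (infixl "\<cdot>" 70)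
    and ast :: "'a \<Rightarrow> 'a \<Rightarrow> 'a" (infixl "\<star>" 70)
  assumes dot_closed: "x \<in> X \<Longrightarrow> y \<in> X \<Longrightarrow> x \<cdot> y \<in> X"
    and ast_closed: "x \<in> X \<Longrightarrow> y \<in> X \<Longrightarrow> x \<star> y \<in> X"

locale plonka_bi_magma = bi_magma +
  assumes dot_right_comm:
      "x \<in> X \<Longrightarrow> y \<in> X \<Longrightarrow> z \<in> X \<Longrightarrow> (x \<cdot> y) \<cdot> z = (x \<cdot> z) \<cdot> y"
    and dot_dot:
      "x \<in> X \<Longrightarrow> y \<in> X \<Longrightarrow> z \<in> X \<Longrightarrow> x \<cdot> (y \<cdot> z) = x \<cdot> y"
    and ast_left_comm:
      "x \<in> X \<Longrightarrow> y \<in> X \<Longrightarrow> z \<in> X \<Longrightarrow> x \<star> (y \<star> z) = y \<star> (x \<star> z)"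
    and ast_ast:
      "x \<in> X \<Longrightarrow> y \<in> X \<Longrightarrow> z \<in> X \<Longrightarrow> (x \<star> y) \<star> z = y \<star> z"
    and ast_dot_assoc:
      "x \<in> X \<Longrightarrow> y \<in> X \<Longrightarrow> z \<in> X \<Longrightarrow> x \<star> (y \<cdot> z) = (x \<star> y) \<cdot> z"
    and dot_ast:
      "x \<in> X \<Longrightarrow> y \<in> X \<Longrightarrow> z \<in> X \<Longrightarrow> (x \<cdot> z) \<star> y = x \<star> y"
    and dot_of_ast:
      "x \<in> X \<Longrightarrow> y \<in> X \<Longrightarrow> z \<in> X \<Longrightarrow> x \<cdot> (y \<star> z) = x \<cdot> z"

locale unitary_plonka_bi_magma = plonka_bi_magma +
  assumes unitary: "x \<in> X \<Longrightarrow> y \<in> X \<Longrightarrow> (x \<star> y) \<cdot> x = y"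

text \<open>
  The parts are \<open>A i\<close> for \<open>i \<in> I\<close>. In \<open>f i j\<close> and \<open>g i j\<close> the first argument is the subscript
  (the part on which the function lives) and the second one the superscript. These functions matter
  only on \<open>A i\<close>, so all equations between them are stated pointwise there.
\<close>

locale plonka_data =
  fixes X :: "'a set"
    and I :: "'i set"
    and A :: "'i \<Rightarrow> 'a set"
    and f g :: "'i \<Rightarrow> 'i \<Rightarrow> 'a \<Rightarrow> 'a"
  assumes cover: "(\<Union>i\<in>I. A i) = X"
    and disjoint: "disjoint_family_on A I"
    and nonempty: "i \<in> I \<Longrightarrow> A i \<noteq> {}"
    and f_maps: "i \<in> I \<Longrightarrow> j \<in> I \<Longrightarrow> f i j \<in> A i \<rightarrow> A i"
    and g_maps: "i \<in> I \<Longrightarrow> j \<in> I \<Longrightarrow> g i j \<in> A i \<rightarrow> A i"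
    and f_f_comm: "i \<in> I \<Longrightarrow> j \<in> I \<Longrightarrow> k \<in> I \<Longrightarrow> x \<in> A i \<Longrightarrow> f i j (f i k x) = f i k (f i j x)"
    and g_g_comm: "i \<in> I \<Longrightarrow> j \<in> I \<Longrightarrow> k \<in> I \<Longrightarrow> x \<in> A i \<Longrightarrow> g i j (g i k x) = g i k (g i j x)"
    and g_f_comm: "i \<in> I \<Longrightarrow> j \<in> I \<Longrightarrow> k \<in> I \<Longrightarrow> x \<in> A i \<Longrightarrow> g i j (f i k x) = f i k (g i j x)"

definition given_by_data ::
  "'i set \<Rightarrow> ('i \<Rightarrow> 'a set) \<Rightarrow> ('i \<Rightarrow> 'i \<Rightarrow> 'a \<Rightarrow> 'a) \<Rightarrow> ('i \<Rightarrow> 'i \<Rightarrow> 'a \<Rightarrow> 'a) \<Rightarrow>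
    ('a \<Rightarrow> 'a \<Rightarrow> 'a) \<Rightarrow> ('a \<Rightarrow> 'a \<Rightarrow> 'a) \<Rightarrow> bool" where
  "given_by_data I A f g dot ast \<longleftrightarrow>
    (\<forall>i\<in>I. \<forall>j\<in>I. \<forall>x\<in>A i. \<forall>y\<in>A j. dot x y = f i j x \<and> ast x y = g j i y)"

definition mutually_inverse_on :: "'a set \<Rightarrow> ('a \<Rightarrow> 'a) \<Rightarrow> ('a \<Rightarrow> 'a) \<Rightarrow> bool" where
  "mutually_inverse_on S p q \<longleftrightarrow>
    bij_betw p S S \<and> bij_betw q S S \<and> (\<forall>x\<in>S. q (p x) = x) \<and> (\<forall>x\<in>S. p (q x) = x)"

end

theory Submission imports Defs begin

text \<open>
  Call \<open>y\<close> and \<open>z\<close> equivalent if \<open>x \<cdot> y = x \<cdot> z\<close> and \<open>y \<star> x = z \<star> x\<close> for all \<open>x\<close>. The axioms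
  without commutation content say that \<open>y \<cdot> z\<close> and \<open>z \<star> y\<close> are equivalent to \<open>y\<close>, so right \<open>\<cdot>\<close>-translations and left \<open>\<star>\<close>-translations
  preserve each class and depend only on the class of the translating element; the remaining axioms
  say that these translations commute. Unitarity says that \<open>f i j\<close> is a left inverse of \<open>g i j\<close>, and
  it is also a right inverse because the two commute.
\<close>

context plonka_bi_magma
begin

definition same_action :: "('a \<times> 'a) set" where
  "same_action = {(y, z) \<in> X \<times> X. \<forall>x\<in>X. x \<cdot> y = x \<cdot> z \<and> y \<star> x = z \<star> x}"

lemma equiv_same_action: "equiv X same_action"
  by (rule equivI) (auto simp: same_action_def refl_on_def sym_def trans_def)

lemma same_action_dot: "y \<in> X \<Longrightarrow> z \<in> X \<Longrightarrow> (y, y \<cdot> z) \<in> same_action"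
  by (simp add: same_action_def dot_closed dot_dot dot_ast)

lemma same_action_ast: "y \<in> X \<Longrightarrow> z \<in> X \<Longrightarrow> (y, z \<star> y) \<in> same_action"
  by (simp add: same_action_def ast_closed ast_ast dot_of_ast)

text \<open>The data needs one function per pair of classes: a chosen element acts for its whole
  class, and by \<open>dot_ast_rep\<close> the choice is immaterial.\<close>

definition rep :: "'a set \<Rightarrow> 'a" where
  "rep C = (SOME x. x \<in> C)"

lemma rep_in_class: "C \<in> X // same_action \<Longrightarrow> rep C \<in> C"
  unfolding rep_def using in_quotient_imp_non_empty[OF equiv_same_action, of C]
  by (simp add: some_in_eq)

lemma class_subset: "C \<in> X // same_action \<Longrightarrow> C \<subseteq> X"
  by (rule in_quotient_imp_subset[OF equiv_same_action])

lemma rep_in_carrier: "C \<in> X // same_action \<Longrightarrow> rep C \<in> X"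
  using rep_in_class class_subset by blast

lemma dot_in_class: "C \<in> X // same_action \<Longrightarrow> y \<in> C \<Longrightarrow> z \<in> X \<Longrightarrow> y \<cdot> z \<in> C"
  using in_quotient_imp_closed[OF equiv_same_action] same_action_dot class_subset by blast

lemma ast_in_class: "C \<in> X // same_action \<Longrightarrow> y \<in> C \<Longrightarrow> z \<in> X \<Longrightarrow> z \<star> y \<in> C"
  using in_quotient_imp_closed[OF equiv_same_action] same_action_ast class_subset by blast

lemma dot_ast_rep:
  assumes "C \<in> X // same_action" "y \<in> C" "x \<in> X"
  shows "x \<cdot> y = x \<cdot> rep C" "y \<star> x = rep C \<star> x"
  using quotient_eq_iff[OF equiv_same_action assms(1,1,2) rep_in_class[OF assms(1)]] assms(3)
  by (simp_all add: same_action_def)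

text \<open>The classes index themselves, hence the family \<open>id\<close>. With representatives
  as translating elements, the three commutation conditions are instances of
  \<open>dot_right_comm\<close>, \<open>ast_left_comm\<close> and
  \<open>ast_dot_assoc\<close>.\<close>

lemma plonka_data_quotient:
  "plonka_data X (X // same_action) id (\<lambda>_ D x. x \<cdot> rep D) (\<lambda>_ D x. rep D \<star> x)"
proof
  show "(\<Union>C\<in>X // same_action. id C) = X"
    using Union_quotient[OF equiv_same_action] by simp
  show "disjoint_family_on id (X // same_action)"
    using quotient_disj[OF equiv_same_action] by (force simp: disjoint_family_on_def)
  show "id C \<noteq> {}" if "C \<in> X // same_action" for C
    using rep_in_class[OF that] by auto
qed (auto simp: dot_in_class ast_in_class rep_in_carrier
    intro: dot_right_comm ast_left_comm ast_dot_assoc dest: class_subset[THEN subsetD])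

lemma given_by_data_quotient:
  "given_by_data (X // same_action) id (\<lambda>_ D x. x \<cdot> rep D) (\<lambda>_ D x. rep D \<star> x) (\<cdot>) (\<star>)"
  unfolding given_by_data_def id_apply by (meson dot_ast_rep class_subset subsetD)

end

context plonka_data
begin

lemma part_unique: "i \<in> I \<Longrightarrow> j \<in> I \<Longrightarrow> x \<in> A i \<Longrightarrow> x \<in> A j \<Longrightarrow> i = j"
  using disjoint by (auto simp: disjoint_family_on_def)

lemma part_subset: "i \<in> I \<Longrightarrow> x \<in> A i \<Longrightarrow> x \<in> X"
  using cover by auto

lemma part_exists:
  assumes "x \<in> X"
  obtains i where "i \<in> I" "x \<in> A i"
  using assms cover by auto

lemma f_in: "i \<in> I \<Longrightarrow> j \<in> I \<Longrightarrow> x \<in> A i \<Longrightarrow> f i j x \<in> A i"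
  using f_maps by auto

lemma g_in: "i \<in> I \<Longrightarrow> j \<in> I \<Longrightarrow> x \<in> A i \<Longrightarrow> g i j x \<in> A i"
  using g_maps by auto

lemma ex_given_by_data: "\<exists>dot ast. given_by_data I A f g dot ast"
proof -
  \<comment> \<open>Disjointness makes the part unique. Outside \<open>X\<close> the value is
    unspecified, which is harmless because \<open>given_by_data\<close> speaks of elements of parts
    only.\<close>
  define part where "part x = (THE i. i \<in> I \<and> x \<in> A i)" for x
  have part: "part x = i" if "i \<in> I" "x \<in> A i" for x i
    unfolding part_def using that part_unique by blast
  have "given_by_data I A f g (\<lambda>x y. f (part x) (part y) x) (\<lambda>x y. g (part y) (part x) y)"
    by (simp add: given_by_data_def part)
  then show ?thesis by blast
qed

context
  fixes dot :: "'a \<Rightarrow> 'a \<Rightarrow> 'a" (infixl "\<cdot>" 70)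
    and ast :: "'a \<Rightarrow> 'a \<Rightarrow> 'a" (infixl "\<star>" 70)
  assumes given: "given_by_data I A f g (\<cdot>) (\<star>)"
begin

lemma dot_eq: "i \<in> I \<Longrightarrow> j \<in> I \<Longrightarrow> x \<in> A i \<Longrightarrow> y \<in> A j \<Longrightarrow> x \<cdot> y = f i j x"
  and ast_eq: "i \<in> I \<Longrightarrow> j \<in> I \<Longrightarrow> x \<in> A i \<Longrightarrow> y \<in> A j \<Longrightarrow> x \<star> y = g j i y"
  using given by (auto simp: given_by_data_def)

text \<open>A product \<open>x \<cdot> y\<close> stays in the part of \<open>x\<close> and
  \<open>x \<star> y\<close> in the part of \<open>y\<close>, so every axiom becomes an identity
  between functions on a single part.\<close>

lemma plonka_bi_magma_of_data: "plonka_bi_magma X (\<cdot>) (\<star>)"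
proof
  fix x y assume "x \<in> X" "y \<in> X"
  then obtain i j where "i \<in> I" "x \<in> A i" "j \<in> I" "y \<in> A j"
    by (meson part_exists)
  then show "x \<cdot> y \<in> X" "x \<star> y \<in> X"
    by (auto simp: dot_eq[of i j] ast_eq[of i j] intro: part_subset f_in g_in)
next
  fix x y z assume "x \<in> X" "y \<in> X" "z \<in> X"
  then obtain i j k where ijk: "i \<in> I" "x \<in> A i" "j \<in> I" "y \<in> A j" "k \<in> I" "z \<in> A k"
    by (meson part_exists)
  note simps = dot_eq[of i j] dot_eq[of i k] dot_eq[of j k] dot_eq[of k j]
    ast_eq[of i j] ast_eq[of i k] ast_eq[of j k] f_in g_in
  \<comment> \<open>The first, third and fifth laws are commutation on \<open>A i\<close>,
    \<open>A k\<close> and \<open>A j\<close> respectively; in the other four both sides apply the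
    same function to the same element.\<close>
  show "x \<cdot> y \<cdot> z = x \<cdot> z \<cdot> y" "x \<cdot> (y \<cdot> z) = x \<cdot> y" "x \<star> (y \<star> z) = y \<star> (x \<star> z)"
    "x \<star> y \<star> z = y \<star> z" "x \<star> (y \<cdot> z) = x \<star> y \<cdot> z" "x \<cdot> z \<star> y = x \<star> y" "x \<cdot> (y \<star> z) = x \<cdot> z"
    using ijk by (simp_all add: simps f_f_comm[of i j k] g_g_comm[of k i j] g_f_comm[of j i k])
qed

lemma unitary_iff_mutually_inverse:
  "unitary_plonka_bi_magma X (\<cdot>) (\<star>) \<longleftrightarrow>
    (\<forall>i\<in>I. \<forall>j\<in>I. mutually_inverse_on (A i) (f i j) (g i j))"
proof
  assume "unitary_plonka_bi_magma X (\<cdot>) (\<star>)"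
  then interpret unitary_plonka_bi_magma X "(\<cdot>)" "(\<star>)" .
  show "\<forall>i\<in>I. \<forall>j\<in>I. mutually_inverse_on (A i) (f i j) (g i j)"
  proof (intro ballI)
    fix i j assume ij: "i \<in> I" "j \<in> I"
    \<comment> \<open>Unitarity speaks of elements, so the index \<open>j\<close> has to be realized
      by some element of its part.\<close>
    then obtain x where x: "x \<in> A j"
      using nonempty by blast
    have fg: "f i j (g i j y) = y" if "y \<in> A i" for y
      using unitary[of x y] that x ij
      by (simp add: part_subset[of i] part_subset[of j] ast_eq[of j i] dot_eq[of i j] g_in)
    \<comment> \<open>Commutation turns \<open>g i j (f i j y)\<close> into
      \<open>f i j (g i j y)\<close>.\<close>
    have gf: "g i j (f i j y) = y" if "y \<in> A i" for y
      using fg that ij by (simp add: g_f_comm)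
    have "bij_betw (f i j) (A i) (A i)"
      by (rule bij_betw_byWitness[of _ "g i j"]) (use ij fg gf f_in g_in in auto)
    moreover have "bij_betw (g i j) (A i) (A i)"
      by (rule bij_betw_byWitness[of _ "f i j"]) (use ij fg gf f_in g_in in auto)
    ultimately show "mutually_inverse_on (A i) (f i j) (g i j)"
      by (simp add: mutually_inverse_on_def fg gf)
  qed
next
  assume inverse: "\<forall>i\<in>I. \<forall>j\<in>I. mutually_inverse_on (A i) (f i j) (g i j)"
  interpret plonka_bi_magma X "(\<cdot>)" "(\<star>)"
    by (rule plonka_bi_magma_of_data)
  show "unitary_plonka_bi_magma X (\<cdot>) (\<star>)"
  proof
    fix x y assume "x \<in> X" "y \<in> X"
    then obtain i j where "i \<in> I" "x \<in> A i" "j \<in> I" "y \<in> A j"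
      by (meson part_exists)
    \<comment> \<open>As \<open>x \<star> y\<close> is again in \<open>A j\<close>, the left-hand
      side is \<open>f j i (g j i y)\<close>.\<close>
    then show "x \<star> y \<cdot> x = y"
      using inverse by (simp add: ast_eq[of i j] dot_eq[of j i] g_in mutually_inverse_on_def)
  qed
qed

end

end

text \<open>HOL cannot quantify over the index type. The existence claim uses indices of type
  \<open>'a set\<close>, where the classes live; the claims about given data hold for an arbitrary
  type \<open>'i\<close>.\<close>

theorem theorem3p24:
  fixes X :: "'a set"
  shows "(\<forall>dot ast. bi_magma X dot ast \<longrightarrow>
            (plonka_bi_magma X dot ast \<longleftrightarrow>
              (\<exists>(I :: 'a set set) A f g. plonka_data X I A f g \<and> given_by_data I A f g dot ast)))
       \<and> (\<forall>(I :: 'i set) A f g. plonka_data X I A f g \<longrightarrow>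
            (\<exists>dot ast. given_by_data I A f g dot ast) \<and>
            (\<forall>dot ast. given_by_data I A f g dot ast \<longrightarrow>
              plonka_bi_magma X dot ast \<and>
              (unitary_plonka_bi_magma X dot ast \<longleftrightarrow>
                (\<forall>i\<in>I. \<forall>j\<in>I. mutually_inverse_on (A i) (f i j) (g i j)))))"
proof (intro conjI allI impI)
  fix dot ast :: "'a \<Rightarrow> 'a \<Rightarrow> 'a"
  show "plonka_bi_magma X dot ast \<longleftrightarrow>
    (\<exists>(I :: 'a set set) A f g. plonka_data X I A f g \<and> given_by_data I A f g dot ast)"
    using plonka_bi_magma.plonka_data_quotient plonka_bi_magma.given_by_data_quotient
      plonka_data.plonka_bi_magma_of_data by blast
qed (simp_all add: plonka_data.ex_given_by_data plonka_data.plonka_bi_magma_of_data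
    plonka_data.unitary_iff_mutually_inverse)

end
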